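(* Let $\alpha\in[0,1]$ be real. Let $G$ be a graph of order $n$ and let $H_1,H_2,\ldots,H_{2n}$ be a family of (pairwise) $A_\alpha$-cospectral graphs such that $\chi_{A_\alpha(H_1)}(\lambda)=\cdots=\chi_{A_\alpha(H_{2n})}(\lambda)=\chi(\lambda)$. Then the generalized coronas $G\tilde{o}\wedge_{i=1}^n H_i$ and $G\tilde{o}\wedge_{i=n+1}^{2n} H_i$ are $A_\alpha$-cospectral.
   Context: All graphs are finite, simple and undirected. For a graph $G$ with adjacency matrix $A(G)$ and diagonal degree matrix $D(G)$, and real $\alpha\in[0,1]$, $A_\alpha(G)=\alpha D(G)+(1-\alpha)A(G)$. Two non-isomorphic graphs are said to be $A_\alpha$-cospectral if they have the same $A_\alpha$-spectrum, i.e. the same multiset of eigenvalues of $A_\alpha$. The generalized corona $G\tilde{o}\wedge_{i=1}^n H_i$ (where $n=|V(G)|$) is the graph obtained by taking one copy of each of $G,H_1,\ldots,H_n$ (pairwise disjoint) and joining the $i$th vertex of $G$ to every vertex of $H_i$, for $1\le i\le n$; in $G\tilde{o}\wedge_{i=n+1}^{2n}H_i$ the $i$th vertex of $G$ is joined to every vertex of $H_{n+i}$. The $A_\alpha$-coronal of a graph $H$ of order $t$ is the rational function $\chi_{A_\alpha(H)}(\lambda)=\mathbf{1}_t^T\big((\lambda-\alpha)I_t-A_\alpha(H)\big)^{-1}\mathbf{1}_t$, where $\mathbf{1}_t$ is the all-ones column vector. *)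

theory Defs
  imports
    "Graph_Theory.Graph_Theory"
    "Jordan_Normal_Form.Gauss_Jordan_Elimination"
    "Jordan_Normal_Form.Char_Poly"
    "HOL-Computational_Algebra.Polynomial_Factorial"
    "HOL-Library.Countable_Set"
begin

text \<open>
  A finite simple undirected graph is a \<open>pair_graph\<close>: finite vertex set, arcs are ordered pairs of
  vertices, the arc relation is symmetric and irreflexive. An edge is thus a pair of opposite arcs,
  and the degree of a vertex is its out-degree.
\<close>

abbreviation graph_order :: "'a pair_pre_digraph \<Rightarrow> nat" where
  "graph_order G \<equiv> card (pverts G)"

text \<open>
  Matrices are indexed by \<open>0, \<dots>, graph_order G - 1\<close> through the fixed enumeration
  \<open>from_nat_into (pverts G)\<close>, a bijection from \<open>{..<graph_order G}\<close> onto \<open>pverts G\<close> when the vertex set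
  is finite. Another enumeration conjugates the matrices by a permutation matrix, so the spectrum
  and the coronal do not depend on it.
\<close>

definition adjacency_mat :: "'a pair_pre_digraph \<Rightarrow> real mat" where
  "adjacency_mat G = mat (graph_order G) (graph_order G)
     (\<lambda>(i, j). if (from_nat_into (pverts G) i, from_nat_into (pverts G) j) \<in> parcs G then 1 else 0)"

definition degree_mat :: "'a pair_pre_digraph \<Rightarrow> real mat" where
  "degree_mat G = mat (graph_order G) (graph_order G)
     (\<lambda>(i, j). if i = j then real (out_degree (with_proj G) (from_nat_into (pverts G) i)) else 0)"

definition A_alpha :: "real \<Rightarrow> 'a pair_pre_digraph \<Rightarrow> real mat" where
  "A_alpha \<alpha> G = \<alpha> \<cdot>\<^sub>m degree_mat G + (1 - \<alpha>) \<cdot>\<^sub>m adjacency_mat G"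

text \<open>
  The multiset of eigenvalues, counted with algebraic multiplicity. It is taken over the complex
  numbers, where the characteristic polynomial splits; the matrix is real symmetric, so all of its
  eigenvalues are real.
\<close>

definition A_alpha_spectrum :: "real \<Rightarrow> 'a pair_pre_digraph \<Rightarrow> complex multiset" where
  "A_alpha_spectrum \<alpha> G = proots (char_poly (map_mat complex_of_real (A_alpha \<alpha> G)))"

definition A_alpha_cospectral ::
    "real \<Rightarrow> 'a pair_pre_digraph \<Rightarrow> 'b pair_pre_digraph \<Rightarrow> bool" where
  "A_alpha_cospectral \<alpha> G H \<longleftrightarrow>
     \<not> digraph_iso (with_proj G) (with_proj H) \<and> A_alpha_spectrum \<alpha> G = A_alpha_spectrum \<alpha> H"

text \<open>
  The coronal is an element of the field of rational functions over the reals, represented as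
  \<open>real poly fract\<close>; the indeterminate is \<open>to_fract [:0, 1:]\<close>. The matrix being inverted has a
  monic polynomial of degree \<open>graph_order H\<close> as its determinant, so it is always invertible over this
  field and \<open>mat_inverse\<close> does not return \<open>None\<close>.
\<close>

definition A_alpha_coronal :: "real \<Rightarrow> 'a pair_pre_digraph \<Rightarrow> real poly fract" where
  "A_alpha_coronal \<alpha> H =
     (let t = graph_order H;
          ones = vec t (\<lambda>_. 1);
          M = (to_fract [:0, 1:] - to_fract [:\<alpha>:]) \<cdot>\<^sub>m 1\<^sub>m t
                - map_mat (\<lambda>c. to_fract [:c:]) (A_alpha \<alpha> H)
      in ones \<bullet> (the (mat_inverse M) *\<^sub>v ones))"

text \<open>
  Here \<open>v\<close> enumerates the vertices of \<open>G\<close> as \<open>v 1, \<dots>, v n\<close>, where \<open>n = graph_order G\<close>.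
  The disjoint copies are \<open>Inl u\<close> for the vertices \<open>u\<close> of \<open>G\<close> and \<open>Inr (i, x)\<close> for the vertices
  \<open>x\<close> of \<open>H i\<close>.
\<close>

definition generalized_corona ::
    "'a pair_pre_digraph \<Rightarrow> (nat \<Rightarrow> 'a) \<Rightarrow> (nat \<Rightarrow> 'b pair_pre_digraph)
      \<Rightarrow> ('a + nat \<times> 'b) pair_pre_digraph" where
  "generalized_corona G v H =
     \<lparr> pverts = Inl ` pverts G \<union> {Inr (i, x) | i x. i \<in> {1..graph_order G} \<and> x \<in> pverts (H i)},
       parcs = {(Inl u, Inl w) | u w. (u, w) \<in> parcs G}
         \<union> {(Inr (i, x), Inr (i, y)) | i x y. i \<in> {1..graph_order G} \<and> (x, y) \<in> parcs (H i)}
         \<union> {(Inl (v i), Inr (i, x)) | i x. i \<in> {1..graph_order G} \<and> x \<in> pverts (H i)}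
         \<union> {(Inr (i, x), Inl (v i)) | i x. i \<in> {1..graph_order G} \<and> x \<in> pverts (H i)} \<rparr>"

lemma pair_graph_generalized_corona:
  assumes G: "pair_graph G"
    and v: "bij_betw v {1..graph_order G} (pverts G)"
    and H: "\<And>i. i \<in> {1..graph_order G} \<Longrightarrow> pair_graph (H i)"
  shows "pair_graph (generalized_corona G v H)"
proof -
  let ?C = "generalized_corona G v H"
  let ?E = "parcs (generalized_corona G v H)"
  note def = generalized_corona_def pair_pre_digraph.simps
  interpret G: pair_graph G by (rule G)
  have vG: "v i \<in> pverts G" if "i \<in> {1..graph_order G}" for i
    using v that by (auto simp: bij_betw_def)
  have pg: "(\<forall>x y. (x, y) \<in> parcs K \<longrightarrow> x \<in> pverts K \<and> y \<in> pverts K \<and> x \<noteq> y \<and> (y, x) \<in> parcs K)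
      \<and> finite (pverts K)" if "pair_graph K" for K :: "'c pair_pre_digraph"
  proof -
    interpret pair_graph K by (rule that)
    have "sym (parcs K)" using pair_sym_arcs by (simp add: symmetric_def)
    then show ?thesis
      using wellformed' pair_no_loops pair_finite_verts by (metis fst_conv snd_conv symD)
  qed
  note Gp = pg[OF G] and Hp = pg[OF H]
  have cases: "P e" if e: "e \<in> ?E"
    and "\<And>u w. (u, w) \<in> parcs G \<Longrightarrow> P (Inl u, Inl w)"
    and "\<And>i x y. i \<in> {1..graph_order G} \<Longrightarrow> (x, y) \<in> parcs (H i) \<Longrightarrow> P (Inr (i, x), Inr (i, y))"
    and "\<And>i x. i \<in> {1..graph_order G} \<Longrightarrow> x \<in> pverts (H i) \<Longrightarrow> P (Inl (v i), Inr (i, x))"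
    and "\<And>i x. i \<in> {1..graph_order G} \<Longrightarrow> x \<in> pverts (H i) \<Longrightarrow> P (Inr (i, x), Inl (v i))"
    for P e
    using e unfolding def by (elim UnE CollectE exE conjE) (simp_all only: that(2-))
  have E: "\<And>u w. (u, w) \<in> parcs G \<Longrightarrow> (Inl u, Inl w) \<in> ?E"
    "\<And>i x y. i \<in> {1..graph_order G} \<Longrightarrow> (x, y) \<in> parcs (H i) \<Longrightarrow> (Inr (i, x), Inr (i, y)) \<in> ?E"
    "\<And>i x. i \<in> {1..graph_order G} \<Longrightarrow> x \<in> pverts (H i) \<Longrightarrow> (Inl (v i), Inr (i, x)) \<in> ?E"
    "\<And>i x. i \<in> {1..graph_order G} \<Longrightarrow> x \<in> pverts (H i) \<Longrightarrow> (Inr (i, x), Inl (v i)) \<in> ?E"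
    unfolding def by blast+
  have V: "pverts ?C = Inl ` pverts G \<union> Inr ` (SIGMA i : {1..graph_order G}. pverts (H i))"
    unfolding def by blast
  have fin: "finite (pverts ?C)"
    unfolding V using Gp Hp by (intro finite_UnI finite_imageI finite_SigmaI) simp_all
  have sub: "fst e \<in> pverts ?C \<and> snd e \<in> pverts ?C" if "e \<in> ?E" for e
    using that by (rule cases) (use Gp Hp vG in \<open>auto simp: V\<close>)
  then have "?E \<subseteq> pverts ?C \<times> pverts ?C" by force
  then have fin': "finite ?E" using fin finite_subset by blast
  have loop: "fst e \<noteq> snd e" if "e \<in> ?E" for e
    using that by (rule cases) (use Gp Hp in auto)
  have "(snd e, fst e) \<in> ?E" if "e \<in> ?E" for e
    using that by (rule cases) (use Gp Hp in \<open>auto intro: E\<close>)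
  then have sym: "symmetric (with_proj ?C)"
    by (auto intro!: symI simp: symmetric_def)
  show ?thesis
    by unfold_locales (use sub fin fin' loop sym in blast)+
qed

end

theory Submission
  imports Defs "Subresultants.More_Homomorphisms"
begin

text \<open>
  Write \<open>\<lambda>\<close> for the indeterminate and fix one block \<open>H k\<close> of a generalized corona. Attaching \<open>H k\<close> to
  the vertex \<open>v k\<close> raises the degree of each of its vertices by one, so the block of
  \<open>\<lambda> I - A\<^sub>\<alpha>\<close> of the corona that belongs to \<open>H k\<close> is \<open>B = (\<lambda> - \<alpha>) I - A\<^sub>\<alpha>(H k)\<close>, exactly the matrix whose
  inverse defines the coronal. The only other vertex adjacent to this block is \<open>v k\<close>, which is
  adjacent to all of it; the off-diagonal blocks therefore have rank one, with all-ones factors on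
  the side of \<open>H k\<close>. By the Schur complement (\<open>det_border_coronal\<close>) the determinant depends on \<open>B\<close>
  only through \<open>det B\<close>, which is the characteristic polynomial of \<open>A\<^sub>\<alpha>(H k)\<close> shifted by \<open>\<alpha>\<close>, and
  through the coronal \<open>1\<^sup>T B\<^sup>-\<^sup>1 1\<close>. The remaining entries see \<open>H k\<close> only in the degree of \<open>v k\<close>, that is,
  in the order of \<open>H k\<close>. So a block may be exchanged for another one with the same spectrum and
  coronal without changing the characteristic polynomial of the corona (\<open>char_poly_corona_update\<close>),
  and exchanging the blocks one at a time turns the first corona into the second
  (\<open>char_poly_corona_cong\<close>).

  Cospectrality also demands that the two coronas are not isomorphic. All blocks have the same
  order \<open>t\<close>, so the vertices of \<open>G\<close> have degree at least \<open>t\<close> and those of the blocks at most \<open>t\<close>. This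
  separates the two kinds of vertices well enough that an isomorphism of the coronas forces each
  block of the first to be isomorphic to some block of the second
  (\<open>corona_iso_imp_block_iso\<close>), whereas the blocks are pairwise non-isomorphic.
\<close>

section \<open>Determinants of bordered matrices\<close>

text \<open>
  The matrices of a graph refer to a fixed enumeration of its vertices; the block structure of a corona
  shows only in another one. Changing the enumeration permutes rows and columns by the same
  permutation, and the two signs cancel.
\<close>

lemma det_enumeration_independent:
  fixes F :: "'v \<Rightarrow> 'v \<Rightarrow> 'a :: comm_ring_1"
  assumes e: "bij_betw e {0..<N} V" and e': "bij_betw e' {0..<N} V"
  shows "det (mat N N (\<lambda>(i, j). F (e i) (e j))) = det (mat N N (\<lambda>(i, j). F (e' i) (e' j)))"
proof -
  define p where "p i = (if i \<in> {0..<N} then inv_into {0..<N} e' (e i) else i)" for i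
  have "bij_betw (inv_into {0..<N} e' \<circ> e) {0..<N} {0..<N}"
    using e bij_betw_inv_into[OF e'] by (rule bij_betw_trans)
  then have "bij_betw p {0..<N} {0..<N}"
    by (rule iffD1[OF bij_betw_cong, rotated]) (simp add: p_def)
  then have p: "p permutes {0..<N}"
    by (rule bij_imp_permutes) (simp add: p_def)
  have e'p: "e' (p i) = e i" if "i < N" for i
  proof -
    have "e i \<in> e' ` {0..<N}"
      using that e e' by (auto simp: bij_betw_def)
    with that show ?thesis by (simp add: p_def f_inv_into_f)
  qed
  have pN: "p i < N" if "i < N" for i
    using permutes_in_image[OF p, of i] that by simp
  let ?A = "mat N N (\<lambda>(i, j). F (e' i) (e' j))"
  let ?B = "mat N N (\<lambda>(i, j). transpose_mat ?A $$ (p i, j))"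
  have "mat N N (\<lambda>(i, j). F (e i) (e j)) = mat N N (\<lambda>(i, j). transpose_mat ?B $$ (p i, j))"
    by (rule eq_matI) (auto simp: e'p pN)
  then have "det (mat N N (\<lambda>(i, j). F (e i) (e j))) = signof p * det (transpose_mat ?B)"
    by (simp add: det_permute_rows[OF _ p])
  also have "\<dots> = signof p * (signof p * det ?A)"
    by (simp add: det_permute_rows[OF _ p] det_transpose[of _ N])
  also have "\<dots> = det ?A"
    by (simp add: mult.assoc[symmetric] sign_def)
  finally show ?thesis .
qed

text \<open>
  Block column elimination: multiplying on the right by the unitriangular matrix with lower left block
  \<open>- C V\<close> clears the lower left block, because \<open>B (C V) = V\<close>.
\<close>

lemma det_four_block_mat_Schur:
  fixes P :: "'a :: idom mat"
  assumes P: "P \<in> carrier_mat n n" and U: "U \<in> carrier_mat n m" and V: "V \<in> carrier_mat m n"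
    and B: "B \<in> carrier_mat m m" and C: "C \<in> carrier_mat m m" and BC: "B * C = 1\<^sub>m m"
  shows "det (four_block_mat P U V B) = det (P - U * (C * V)) * det B"
proof -
  let ?M = "four_block_mat P U V B"
  let ?L = "four_block_mat (1\<^sub>m n) (0\<^sub>m n m) (- (C * V)) (1\<^sub>m m)"
  have CV: "C * V \<in> carrier_mat m n" using C V by (rule mult_carrier_mat)
  have nCV: "- (C * V) \<in> carrier_mat m n" using CV by simp
  have UCV: "U * (C * V) \<in> carrier_mat n n" using U CV by (rule mult_carrier_mat)
  have L: "?L \<in> carrier_mat (n + m) (n + m)" by simp
  have M: "?M \<in> carrier_mat (n + m) (n + m)" using P B by simp
  have "?M * ?L =
      four_block_mat (P * 1\<^sub>m n + U * - (C * V)) (P * 0\<^sub>m n m + U * 1\<^sub>m m)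
        (V * 1\<^sub>m n + B * - (C * V)) (V * 0\<^sub>m n m + B * 1\<^sub>m m)"
    by (rule mult_four_block_mat[OF P U V B one_carrier_mat zero_carrier_mat nCV one_carrier_mat])
  also have "P * 1\<^sub>m n + U * - (C * V) = P - U * (C * V)"
  proof -
    have "U * - (C * V) = - (U * (C * V))"
      by (rule uminus_mult_right_mat) (use U CV in \<open>simp only: carrier_matD\<close>)
    then show ?thesis
      by (simp only: right_mult_one_mat[OF P] minus_add_uminus_mat[OF P UCV])
  qed
  also have "P * 0\<^sub>m n m + U * 1\<^sub>m m = U"
    by (simp only: right_mult_zero_mat[OF P] right_mult_one_mat[OF U] left_add_zero_mat[OF U])
  also have "V * 1\<^sub>m n + B * - (C * V) = 0\<^sub>m m n"
  proof -
    have "B * - (C * V) = - (B * (C * V))"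
      by (rule uminus_mult_right_mat) (use B CV in \<open>simp only: carrier_matD\<close>)
    also have "B * (C * V) = V"
      by (simp only: assoc_mult_mat[OF B C V, symmetric] BC left_mult_one_mat[OF V])
    finally show ?thesis
      by (intro eq_matI) (use V in auto)
  qed
  also have "V * 0\<^sub>m n m + B * 1\<^sub>m m = B"
    by (simp only: right_mult_zero_mat[OF V] right_mult_one_mat[OF B] left_add_zero_mat[OF B])
  finally have "?M * ?L = four_block_mat (P - U * (C * V)) U (0\<^sub>m m n) B" .
  then have "det (?M * ?L) = det (P - U * (C * V)) * det B"
    using det_four_block_mat_lower_left_zero[OF minus_carrier_mat[OF UCV] U refl B] by simp
  moreover have "det ?L = 1"
    using det_four_block_mat_upper_right_zero[OF one_carrier_mat refl nCV one_carrier_mat]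
    by simp
  ultimately show ?thesis
    using det_mult[OF M L] by simp
qed

definition coronal :: "'a :: field mat \<Rightarrow> 'a" where
  "coronal B = vec (dim_row B) (\<lambda>_. 1) \<bullet> (the (mat_inverse B) *\<^sub>v vec (dim_row B) (\<lambda>_. 1))"

lemma mat_inverse_det_nonzero:
  fixes B :: "'a :: field mat"
  assumes B: "B \<in> carrier_mat m m" and "det B \<noteq> 0"
  shows "the (mat_inverse B) \<in> carrier_mat m m" "B * the (mat_inverse B) = 1\<^sub>m m"
proof -
  have "mat_inverse B \<noteq> None"
    using det_non_zero_imp_unit[OF assms, of undefined] mat_inverse(1)[OF B, of undefined] by blast
  then have "mat_inverse B = Some (the (mat_inverse B))" by simp
  from mat_inverse(2)[OF B this]
  show "the (mat_inverse B) \<in> carrier_mat m m" "B * the (mat_inverse B) = 1\<^sub>m m" by blast+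
qed

text \<open>
  With rank-one borders the product \<open>U B\<^sup>-\<^sup>1 V\<close> in the Schur complement is the coronal of \<open>B\<close> times
  \<open>w w\<^sup>T\<close>, so nothing of \<open>B\<close> but its determinant and its coronal survives.
\<close>

lemma det_border_coronal:
  fixes P :: "'a :: field mat" and w :: "nat \<Rightarrow> 'a"
  assumes P: "P \<in> carrier_mat n n" and B: "B \<in> carrier_mat m m" and nz: "det B \<noteq> 0"
  shows "det (four_block_mat P (mat n m (\<lambda>(i, j). w i)) (mat m n (\<lambda>(i, j). w j)) B) =
    det (P - mat n n (\<lambda>(i, j). w i * coronal B * w j)) * det B"
proof -
  let ?C = "the (mat_inverse B)" and ?U = "mat n m (\<lambda>(i, j). w i)" and ?V = "mat m n (\<lambda>(i, j). w j)"
  have C: "?C \<in> carrier_mat m m" "B * ?C = 1\<^sub>m m"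
    using mat_inverse_det_nonzero[OF B nz] .
  have "?U * (?C * ?V) = mat n n (\<lambda>(i, j). w i * coronal B * w j)"
  proof (rule eq_matI)
    fix i j assume ij: "i < dim_row (mat n n (\<lambda>(i, j). w i * coronal B * w j))"
      "j < dim_col (mat n n (\<lambda>(i, j). w i * coronal B * w j))"
    with B C(1) show "(?U * (?C * ?V)) $$ (i, j) = mat n n (\<lambda>(i, j). w i * coronal B * w j) $$ (i, j)"
      by (simp add: coronal_def scalar_prod_def sum_distrib_left sum_distrib_right mult.assoc)
  qed (use C in auto)
  then show ?thesis
    using det_four_block_mat_Schur[OF P _ _ B C, of ?U ?V] by simp
qed

section \<open>The characteristic matrix and the coronal\<close>

text \<open>
  The entries of \<open>\<lambda> I - A\<^sub>\<alpha>(G)\<close>, indexed by vertices instead of by their numbers. They are taken in the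
  field of rational functions, where the blocks of the matrix can be inverted.
\<close>

definition alpha_char_entry :: "real \<Rightarrow> 'a pair_pre_digraph \<Rightarrow> 'a \<Rightarrow> 'a \<Rightarrow> real poly fract" where
  "alpha_char_entry \<alpha> G x y =
     to_fract ((if x = y then [:- (\<alpha> * real (card (parcs G `` {x}))), 1:] else 0)
       - (if (x, y) \<in> parcs G then [:1 - \<alpha>:] else 0))"

lemma out_degree_with_proj: "out_degree (with_proj G) x = card (parcs G `` {x})"
proof -
  have "out_arcs (with_proj G) x = Pair x ` (parcs G `` {x})"
    by (auto simp: out_arcs_def)
  then show ?thesis by (simp add: out_degree_def card_image inj_on_def)
qed

lemma A_alpha_carrier: "A_alpha \<alpha> G \<in> carrier_mat (graph_order G) (graph_order G)"
  by (simp add: A_alpha_def degree_mat_def adjacency_mat_def)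

lemma from_nat_into_bij_betw_order:
  "finite V \<Longrightarrow> bij_betw (from_nat_into V) {0..<card V} V"
  using bij_betw_from_nat_into_finite[of V] by (simp add: lessThan_atLeast0)

lemma A_alpha_index:
  assumes "finite (pverts G)" "i < graph_order G" "j < graph_order G"
  shows "A_alpha \<alpha> G $$ (i, j) =
    (let x = from_nat_into (pverts G) i; y = from_nat_into (pverts G) j
     in (if x = y then \<alpha> * real (card (parcs G `` {x})) else 0)
        + (if (x, y) \<in> parcs G then 1 - \<alpha> else 0))"
proof -
  have "from_nat_into (pverts G) i = from_nat_into (pverts G) j \<longleftrightarrow> i = j"
    using from_nat_into_bij_betw_order[OF assms(1)] assms(2,3) by (auto simp: bij_betw_def inj_on_def)
  then show ?thesis
    using assms by (simp add: A_alpha_def degree_mat_def adjacency_mat_def out_degree_with_proj Let_def)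
qed

lemma to_fract_char_poly_A_alpha:
  assumes fin: "finite (pverts G)" and e: "bij_betw e {0..<graph_order G} (pverts G)"
  shows "to_fract (char_poly (A_alpha \<alpha> G)) =
    det (mat (graph_order G) (graph_order G) (\<lambda>(i, j). alpha_char_entry \<alpha> G (e i) (e j)))"
proof -
  let ?N = "graph_order G" and ?e = "from_nat_into (pverts G)"
  note b = from_nat_into_bij_betw_order[OF fin]
  have inj: "?e i = ?e j \<longleftrightarrow> i = j" if "i < ?N" "j < ?N" for i j
    using b that by (auto simp: bij_betw_def inj_on_def)
  have "to_fract (char_poly (A_alpha \<alpha> G)) = det (map_mat to_fract (char_poly_matrix (A_alpha \<alpha> G)))"
    by (simp add: char_poly_def)
  also have "map_mat to_fract (char_poly_matrix (A_alpha \<alpha> G))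
      = mat ?N ?N (\<lambda>(i, j). alpha_char_entry \<alpha> G (?e i) (?e j))"
    using A_alpha_carrier[of \<alpha> G]
    by (intro eq_matI)
       (auto simp: char_poly_matrix_def A_alpha_index[OF fin] alpha_char_entry_def inj Let_def
         simp del: to_fract_hom.hom_add to_fract_hom.hom_minus)
  also have "det \<dots> = det (mat ?N ?N (\<lambda>(i, j). alpha_char_entry \<alpha> G (e i) (e j)))"
    using b e by (rule det_enumeration_independent)
  finally show ?thesis .
qed

text \<open>
  This matrix plays two parts: the coronal of \<open>H\<close> is defined by its inverse, and it is the block of the
  characteristic matrix of a corona that belongs to an attached copy of \<open>H\<close>.
\<close>

definition coronal_mat :: "real \<Rightarrow> 'a pair_pre_digraph \<Rightarrow> real poly fract mat" where
  "coronal_mat \<alpha> H = (to_fract [:0, 1:] - to_fract [:\<alpha>:]) \<cdot>\<^sub>m 1\<^sub>m (graph_order H)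
    - map_mat (\<lambda>c. to_fract [:c:]) (A_alpha \<alpha> H)"

lemma coronal_mat_carrier: "coronal_mat \<alpha> H \<in> carrier_mat (graph_order H) (graph_order H)"
  unfolding coronal_mat_def by (intro minus_carrier_mat) (simp add: A_alpha_carrier)

lemma coronal_mat_index:
  assumes "i < graph_order H" "j < graph_order H"
  shows "coronal_mat \<alpha> H $$ (i, j) =
    to_fract ((if i = j then [:- \<alpha>, 1:] else 0) - [:A_alpha \<alpha> H $$ (i, j):])"
proof -
  have "to_fract [:0, 1:] - to_fract [:\<alpha>:] = to_fract ([:0, 1:] - [:\<alpha>:])"
    by (rule to_fract_hom.hom_minus[symmetric])
  also have "\<dots> = to_fract [:- \<alpha>, 1:]" by simp
  finally have "to_fract [:0, 1:] - to_fract [:\<alpha>:] = to_fract [:- \<alpha>, 1:]" .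
  then show ?thesis
    using assms A_alpha_carrier[of \<alpha> H] by (simp add: coronal_mat_def)
qed

lemma A_alpha_coronal_eq:
  "A_alpha_coronal \<alpha> H = coronal (coronal_mat \<alpha> H)"
  using A_alpha_carrier[of \<alpha> H]
  by (simp add: A_alpha_coronal_def coronal_def coronal_mat_def Let_def)

text \<open>
  Substituting \<open>\<lambda> - \<alpha>\<close> for \<open>\<lambda>\<close> is a ring homomorphism, so it commutes with the determinant of the
  characteristic matrix.
\<close>

lemma det_coronal_mat: "det (coronal_mat \<alpha> H) = to_fract (char_poly (A_alpha \<alpha> H) \<circ>\<^sub>p [:- \<alpha>, 1:])"
proof -
  have "comm_ring_hom (\<lambda>q. q \<circ>\<^sub>p [:- \<alpha>, 1:])"
    by unfold_locales (simp_all add: pcompose_add pcompose_mult pcompose_1)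
  note pcompose_det = comm_ring_hom.hom_det[OF this]
  have "coronal_mat \<alpha> H = map_mat to_fract (map_mat (\<lambda>q. q \<circ>\<^sub>p [:- \<alpha>, 1:]) (char_poly_matrix (A_alpha \<alpha> H)))"
    using A_alpha_carrier[of \<alpha> H] coronal_mat_carrier[of \<alpha> H]
    by (intro eq_matI)
       (auto simp: char_poly_matrix_def pcompose_pCons coronal_mat_index
         simp del: to_fract_hom.hom_add to_fract_hom.hom_minus)
  then show ?thesis
    by (simp only: char_poly_def pcompose_det to_fract_hom.hom_det)
qed

lemma det_coronal_mat_nonzero: "det (coronal_mat \<alpha> H) \<noteq> 0"
proof -
  have "char_poly (A_alpha \<alpha> H) \<noteq> 0"
    using degree_monic_char_poly[OF A_alpha_carrier, of \<alpha> H] by auto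
  then show ?thesis
    by (simp add: det_coronal_mat pcompose_eq_0_iff)
qed

text \<open>
  A monic polynomial over the complex numbers is the product of the linear factors of its roots, and
  real polynomials embed into the complex ones; so no information is lost in passing from the
  characteristic polynomial to its multiset of roots.
\<close>

lemma A_alpha_spectrum_eq_iff:
  "A_alpha_spectrum \<alpha> G = A_alpha_spectrum \<alpha> H \<longleftrightarrow> char_poly (A_alpha \<alpha> G) = char_poly (A_alpha \<alpha> H)"
proof
  let ?c = "\<lambda>K. char_poly (map_mat complex_of_real K)"
  have m: "lead_coeff (?c (A_alpha \<alpha> K)) = 1" for K :: "'c pair_pre_digraph"
    using degree_monic_char_poly[of "map_mat complex_of_real (A_alpha \<alpha> K)" "graph_order K"] A_alpha_carrier[of \<alpha> K]
    by simp
  assume "A_alpha_spectrum \<alpha> G = A_alpha_spectrum \<alpha> H"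
  then have "?c (A_alpha \<alpha> G) = ?c (A_alpha \<alpha> H)"
    using complex_poly_decompose_multiset[of "?c (A_alpha \<alpha> G)"] complex_poly_decompose_multiset[of "?c (A_alpha \<alpha> H)"]
    by (simp add: A_alpha_spectrum_def m)
  then show "char_poly (A_alpha \<alpha> G) = char_poly (A_alpha \<alpha> H)"
    by (simp add: of_real_hom.char_poly_hom[OF A_alpha_carrier] poly_eq_iff coeff_map_poly)
next
  assume "char_poly (A_alpha \<alpha> G) = char_poly (A_alpha \<alpha> H)"
  then show "A_alpha_spectrum \<alpha> G = A_alpha_spectrum \<alpha> H"
    by (simp add: A_alpha_spectrum_def of_real_hom.char_poly_hom[OF A_alpha_carrier])
qed

section \<open>The generalized corona and one of its blocks\<close>

lemma pair_graphD:
  assumes "pair_graph K"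
  shows "finite (pverts K)"
    and "(x, y) \<in> parcs K \<Longrightarrow> x \<in> pverts K \<and> y \<in> pverts K \<and> x \<noteq> y \<and> (y, x) \<in> parcs K"
proof -
  interpret pair_graph K by (rule assms)
  show "finite (pverts K)" by (rule pair_finite_verts)
  have "sym (parcs K)" using pair_sym_arcs by (simp add: symmetric_def)
  then show "x \<in> pverts K \<and> y \<in> pverts K \<and> x \<noteq> y \<and> (y, x) \<in> parcs K" if "(x, y) \<in> parcs K"
    using that wellformed' pair_no_loops by (metis fst_conv snd_conv symD)
qed

lemma neighbours_finite:
  assumes "pair_graph K"
  shows "finite (parcs K `` {x})"
  using pair_graphD[OF assms] by (auto intro: finite_subset[of _ "pverts K"])

lemma generalized_corona_verts [simp]:
  "Inl u \<in> pverts (generalized_corona G v H) \<longleftrightarrow> u \<in> pverts G"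
  "Inr (i, x) \<in> pverts (generalized_corona G v H) \<longleftrightarrow> i \<in> {1..graph_order G} \<and> x \<in> pverts (H i)"
  by (auto simp: generalized_corona_def)

lemma generalized_corona_arcs [simp]:
  "(Inl u, Inl w) \<in> parcs (generalized_corona G v H) \<longleftrightarrow> (u, w) \<in> parcs G"
  "(Inl u, Inr (i, x)) \<in> parcs (generalized_corona G v H) \<longleftrightarrow>
    i \<in> {1..graph_order G} \<and> x \<in> pverts (H i) \<and> u = v i"
  "(Inr (i, x), Inl u) \<in> parcs (generalized_corona G v H) \<longleftrightarrow>
    i \<in> {1..graph_order G} \<and> x \<in> pverts (H i) \<and> u = v i"
  "(Inr (i, x), Inr (j, y)) \<in> parcs (generalized_corona G v H) \<longleftrightarrow>
    i = j \<and> i \<in> {1..graph_order G} \<and> (x, y) \<in> parcs (H i)"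
  by (auto simp: generalized_corona_def)

lemma sum_pair_set_eqI:
  assumes "\<And>u. Inl u \<in> A \<longleftrightarrow> Inl u \<in> B" and "\<And>i x. Inr (i, x) \<in> A \<longleftrightarrow> Inr (i, x) \<in> B"
  shows "A = B"
proof -
  have "z \<in> A \<longleftrightarrow> z \<in> B" for z
    using assms by (cases z) (auto simp: split_paired_all)
  then show ?thesis by blast
qed

lemma generalized_corona_cong:
  assumes "\<And>i. i \<in> {1..graph_order G} \<Longrightarrow> H i = K i"
  shows "generalized_corona G v H = generalized_corona G v K"
proof (rule pair_pre_digraph.equality)
  show "pverts (generalized_corona G v H) = pverts (generalized_corona G v K)"
    using assms by (intro sum_pair_set_eqI) auto
  have "(a, b) \<in> parcs (generalized_corona G v H) \<longleftrightarrow> (a, b) \<in> parcs (generalized_corona G v K)" for a b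
    using assms by (cases a; cases b) (auto simp: split_paired_all)
  then show "parcs (generalized_corona G v H) = parcs (generalized_corona G v K)" by auto
qed simp

locale corona =
  fixes G :: "'a pair_pre_digraph" and v :: "nat \<Rightarrow> 'a" and H :: "nat \<Rightarrow> 'b pair_pre_digraph"
  assumes G: "pair_graph G" and v: "bij_betw v {1..graph_order G} (pverts G)"
    and H: "i \<in> {1..graph_order G} \<Longrightarrow> pair_graph (H i)"
begin

abbreviation C :: "('a + nat \<times> 'b) pair_pre_digraph" where
  "C \<equiv> generalized_corona G v H"

lemma C: "pair_graph C"
  using G v H by (rule pair_graph_generalized_corona)

lemma v_in [simp]: "i \<in> {1..graph_order G} \<Longrightarrow> v i \<in> pverts G"
  using v by (auto simp: bij_betw_def)

lemma v_eq_iff: "i \<in> {1..graph_order G} \<Longrightarrow> j \<in> {1..graph_order G} \<Longrightarrow> v i = v j \<longleftrightarrow> i = j"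
  using inj_on_eq_iff[OF bij_betw_imp_inj_on[OF v]] .

lemma v_cases:
  assumes "u \<in> pverts G"
  obtains i where "i \<in> {1..graph_order G}" "u = v i"
  using assms bij_betw_imp_surj_on[OF v] by blast

text \<open>
  A hub is a vertex of \<open>G\<close>, a leaf is a vertex of one of the attached graphs.
\<close>

lemma neighbours_hub:
  assumes i: "i \<in> {1..graph_order G}"
  shows "parcs C `` {Inl (v i)} = Inl ` (parcs G `` {v i}) \<union> Inr ` Pair i ` pverts (H i)"
  using i by (intro sum_pair_set_eqI) (auto simp: v_eq_iff)

lemma degree_hub:
  assumes i: "i \<in> {1..graph_order G}"
  shows "card (parcs C `` {Inl (v i)}) = card (parcs G `` {v i}) + graph_order (H i)"
  unfolding neighbours_hub[OF i]
  using neighbours_finite[OF G, of "v i"] pair_graphD(1)[OF H[OF i]]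
  by (subst card_Un_disjoint) (auto simp: card_image inj_on_def)

lemma neighbours_leaf:
  assumes i: "i \<in> {1..graph_order G}" and x: "x \<in> pverts (H i)"
  shows "parcs C `` {Inr (i, x)} = insert (Inl (v i)) (Inr ` Pair i ` (parcs (H i) `` {x}))"
  using i x by (intro sum_pair_set_eqI) auto

lemma degree_leaf:
  assumes i: "i \<in> {1..graph_order G}" and x: "x \<in> pverts (H i)"
  shows "card (parcs C `` {Inr (i, x)}) = card (parcs (H i) `` {x}) + 1"
  unfolding neighbours_leaf[OF assms]
  using neighbours_finite[OF H[OF i], of x]
  by (subst card_insert_disjoint) (auto simp: card_image inj_on_def)

text \<open>
  The vertices are listed with the block \<open>H k\<close> last, behind an arbitrary enumeration \<open>e\<close> of the others.
  That \<open>e\<close> is arbitrary allows two coronas that differ only in this block to be compared along a common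
  enumeration of the rest. In the lower right block the extra neighbour of each leaf contributes the
  summand \<open>\<alpha>\<close> to its diagonal entry in \<open>A\<^sub>\<alpha>\<close>, whence the shift in the coronal and in the polynomial.
\<close>

lemma to_fract_char_poly_corona:
  fixes \<alpha> :: real
  assumes k: "k \<in> {1..graph_order G}"
    and e: "bij_betw e {0..<m} (pverts C - Inr ` Pair k ` pverts (H k))"
  defines "w \<equiv> \<lambda>i. if e i = Inl (v k) then to_fract [:\<alpha> - 1:] else 0"
  shows "to_fract (char_poly (A_alpha \<alpha> C)) =
    det (mat m m (\<lambda>(i, j). alpha_char_entry \<alpha> C (e i) (e j))
      - mat m m (\<lambda>(i, j). w i * A_alpha_coronal \<alpha> (H k) * w j))
    * to_fract (char_poly (A_alpha \<alpha> (H k)) \<circ>\<^sub>p [:- \<alpha>, 1:])"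
proof -
  let ?t = "graph_order (H k)" and ?h = "from_nat_into (pverts (H k))"
  let ?R = "pverts C - Inr ` Pair k ` pverts (H k)"
  let ?P = "mat m m (\<lambda>(i, j). alpha_char_entry \<alpha> C (e i) (e j))"
  let ?U = "mat m ?t (\<lambda>(i, j). w i)" and ?V = "mat ?t m (\<lambda>(i, j). w j)"
  let ?B = "coronal_mat \<alpha> (H k)"
  note Hk = H[OF k]
  note finH = pair_graphD(1)[OF Hk]
  have h: "bij_betw ?h {0..<?t} (pverts (H k))"
    using finH by (rule from_nat_into_bij_betw_order)
  have hin: "?h i \<in> pverts (H k)" if "i < ?t" for i
    using h that by (auto simp: bij_betw_def)
  have hinj: "?h i = ?h j \<longleftrightarrow> i = j" if "i < ?t" "j < ?t" for i j
    using h that by (auto simp: bij_betw_def inj_on_def)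
  have ein: "e i \<in> ?R" if "i < m" for i
    using bij_betwE[OF e] that by simp
  define d where "d i = (if i < m then e i else Inr (k, ?h (i - m)))" for i
  have "bij_betw d ({0..<m} \<union> {m..<m + ?t}) (?R \<union> Inr ` Pair k ` pverts (H k))"
  proof (rule bij_betw_combine)
    show "bij_betw d {0..<m} ?R"
      using e by (rule iffD1[OF bij_betw_cong, rotated]) (simp add: d_def)
    have "bij_betw (\<lambda>i. i - m) {m..<m + ?t} {0..<?t}"
      by (rule bij_betw_byWitness[where f' = "\<lambda>i. i + m"]) auto
    then have "bij_betw (?h \<circ> (\<lambda>i. i - m)) {m..<m + ?t} (pverts (H k))"
      using h by (rule bij_betw_trans)
    moreover have "bij_betw (Inr \<circ> Pair k) (pverts (H k)) (Inr ` Pair k ` pverts (H k))"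
      by (auto simp: bij_betw_def inj_on_def)
    ultimately have "bij_betw ((Inr \<circ> Pair k) \<circ> (?h \<circ> (\<lambda>i. i - m))) {m..<m + ?t}
        (Inr ` Pair k ` pverts (H k))"
      by (rule bij_betw_trans)
    then show "bij_betw d {m..<m + ?t} (Inr ` Pair k ` pverts (H k))"
      by (rule iffD1[OF bij_betw_cong, rotated]) (simp add: d_def)
  qed auto
  moreover have "?R \<union> Inr ` Pair k ` pverts (H k) = pverts C"
    using k by auto
  moreover have "{0..<m} \<union> {m..<m + ?t} = {0..<m + ?t}" by auto
  ultimately have d: "bij_betw d {0..<m + ?t} (pverts C)" by simp
  have order: "graph_order C = m + ?t"
    using bij_betw_same_card[OF d] by simp
  have border: "alpha_char_entry \<alpha> C (e i) (Inr (k, x)) = w i"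
    "alpha_char_entry \<alpha> C (Inr (k, x)) (e i) = w i" if i: "i < m" and x: "x \<in> pverts (H k)" for i x
  proof -
    consider (Inl) u where "e i = Inl u" | (Inr) j y where "e i = Inr (j, y)" "j \<noteq> k"
    proof (cases "e i")
      case (Inr p)
      moreover have "fst p \<noteq> k"
      proof
        assume "fst p = k"
        then have "p = (k, snd p)" by (metis prod.collapse)
        with ein[OF i] Inr have "Inr (k, snd p) \<in> ?R" by metis
        then show False by auto
      qed
      ultimately show ?thesis using that(2)[of "fst p" "snd p"] by simp
    qed (use that(1) in blast)
    then have "alpha_char_entry \<alpha> C (e i) (Inr (k, x)) = w i
      \<and> alpha_char_entry \<alpha> C (Inr (k, x)) (e i) = w i"
    proof cases
      case Inl
      then show ?thesis
        using x k by (simp add: alpha_char_entry_def w_def del: to_fract_hom.hom_minus to_fract_hom.hom_uminus)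
    next
      case Inr
      then show ?thesis by (simp add: alpha_char_entry_def w_def del: to_fract_hom.hom_minus to_fract_hom.hom_uminus)
    qed
    then show "alpha_char_entry \<alpha> C (e i) (Inr (k, x)) = w i"
      "alpha_char_entry \<alpha> C (Inr (k, x)) (e i) = w i"
      by simp_all
  qed
  have block: "alpha_char_entry \<alpha> C (Inr (k, ?h i)) (Inr (k, ?h j)) = ?B $$ (i, j)"
    if "i < ?t" "j < ?t" for i j
    using that k hin[OF that(1)] hin[OF that(2)] degree_leaf[OF k hin[OF that(2)]]
    by (simp add: alpha_char_entry_def coronal_mat_index A_alpha_index[OF finH] hinj Let_def
        distrib_left del: to_fract_hom.hom_add to_fract_hom.hom_minus)
  have "mat (m + ?t) (m + ?t) (\<lambda>(i, j). alpha_char_entry \<alpha> C (d i) (d j)) = four_block_mat ?P ?U ?V ?B"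
    using coronal_mat_carrier[of \<alpha> "H k"]
    by (intro eq_matI) (auto simp: d_def border block hin)
  then have "to_fract (char_poly (A_alpha \<alpha> C)) = det (four_block_mat ?P ?U ?V ?B)"
    using to_fract_char_poly_A_alpha[OF pair_graphD(1)[OF C], of d \<alpha>] d by (simp add: order)
  also have "\<dots> = det (?P - mat m m (\<lambda>(i, j). w i * coronal ?B * w j)) * det ?B"
    by (rule det_border_coronal[OF _ coronal_mat_carrier det_coronal_mat_nonzero]) simp
  finally show ?thesis
    by (simp add: A_alpha_coronal_eq det_coronal_mat)
qed

end

section \<open>Exchanging blocks\<close>

lemma graph_order_eq_if_char_poly_eq:
  assumes "char_poly (A_alpha \<alpha> H) = char_poly (A_alpha \<alpha> K)"
  shows "graph_order H = graph_order K"
  using degree_monic_char_poly[OF A_alpha_carrier] assms by metis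

text \<open>
  Both coronas have the same vertices outside the block, and the entries there agree: the only
  one that could change is the diagonal entry of \<open>v k\<close>, whose degree involves the block through its order
  alone, and the order is the degree of the characteristic polynomial.
\<close>

lemma (in corona) char_poly_corona_update:
  fixes K :: "'b pair_pre_digraph"
  assumes k: "k \<in> {1..graph_order G}" and K: "pair_graph K"
    and poly: "char_poly (A_alpha \<alpha> K) = char_poly (A_alpha \<alpha> (H k))"
    and coronal: "A_alpha_coronal \<alpha> K = A_alpha_coronal \<alpha> (H k)"
  shows "char_poly (A_alpha \<alpha> (generalized_corona G v (H(k := K)))) = char_poly (A_alpha \<alpha> C)"
proof -
  interpret K: corona G v "H(k := K)"
    using G v H K by (intro corona.intro) auto
  let ?R = "pverts C - Inr ` Pair k ` pverts (H k)"
  have order: "graph_order K = graph_order (H k)"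
    using poly by (rule graph_order_eq_if_char_poly_eq)
  have R: "pverts K.C - Inr ` Pair k ` pverts K = ?R"
    by (rule sum_pair_set_eqI) (auto split: if_splits)
  have "finite ?R"
    using pair_graphD(1)[OF C] by simp
  then obtain e where e: "bij_betw e {0..<card ?R} ?R"
    using ex_bij_betw_nat_finite by blast
  have entry: "alpha_char_entry \<alpha> K.C x y = alpha_char_entry \<alpha> C x y" if x: "x \<in> ?R" and y: "y \<in> ?R" for x y
  proof -
    have "x \<noteq> Inr (k, z) \<and> y \<noteq> Inr (k, z)" for z
      using x y by auto
    then have "(x, y) \<in> parcs K.C \<longleftrightarrow> (x, y) \<in> parcs C"
      by (cases x; cases y) (auto simp: split_paired_all)
    moreover have "card (parcs K.C `` {x}) = card (parcs C `` {x})"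
    proof (cases x)
      case (Inl u)
      then obtain j where "j \<in> {1..graph_order G}" "u = v j"
        using x v_cases[of u] by auto
      then show ?thesis
        using degree_hub[of j] K.degree_hub[of j] order by (simp add: Inl)
    next
      case (Inr p)
      obtain j z where p: "p = (j, z)" by (cases p)
      have "j \<noteq> k" "j \<in> {1..graph_order G}" "z \<in> pverts (H j)"
        using x unfolding Inr p by auto
      then show ?thesis
        using degree_leaf[of j z] K.degree_leaf[of j z] by (simp add: Inr p)
    qed
    ultimately show ?thesis
      by (simp only: alpha_char_entry_def)
  qed
  have ein: "e i \<in> ?R" if "i < card ?R" for i
    using bij_betwE[OF e] that by simp
  have "mat (card ?R) (card ?R) (\<lambda>(i, j). alpha_char_entry \<alpha> K.C (e i) (e j)) =
      mat (card ?R) (card ?R) (\<lambda>(i, j). alpha_char_entry \<alpha> C (e i) (e j))"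
    by (rule eq_matI) (simp_all add: entry[OF ein ein] del: Diff_iff)
  then have "to_fract (char_poly (A_alpha \<alpha> K.C)) = to_fract (char_poly (A_alpha \<alpha> C))"
    using to_fract_char_poly_corona[OF k e, of \<alpha>] K.to_fract_char_poly_corona[OF k, of e "card ?R" \<alpha>] e
    by (simp add: R poly coronal)
  then show ?thesis by simp
qed

text \<open>
  The hybrid coronas \<open>M k\<close>, whose first \<open>k\<close> blocks are already taken from \<open>K\<close>, lead from \<open>H\<close> to \<open>K\<close> by
  exchanging a single block at each step.
\<close>

lemma char_poly_corona_cong:
  fixes H K :: "nat \<Rightarrow> 'b pair_pre_digraph"
  assumes G: "pair_graph G" and v: "bij_betw v {1..graph_order G} (pverts G)"
    and H: "\<And>i. i \<in> {1..graph_order G} \<Longrightarrow> pair_graph (H i)"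
    and K: "\<And>i. i \<in> {1..graph_order G} \<Longrightarrow> pair_graph (K i)"
    and poly: "\<And>i. i \<in> {1..graph_order G} \<Longrightarrow> char_poly (A_alpha \<alpha> (H i)) = char_poly (A_alpha \<alpha> (K i))"
    and coronal: "\<And>i. i \<in> {1..graph_order G} \<Longrightarrow> A_alpha_coronal \<alpha> (H i) = A_alpha_coronal \<alpha> (K i)"
  shows "char_poly (A_alpha \<alpha> (generalized_corona G v H)) = char_poly (A_alpha \<alpha> (generalized_corona G v K))"
proof -
  define M where "M k i = (if i \<le> k then K i else H i)" for k i
  have "char_poly (A_alpha \<alpha> (generalized_corona G v (M k))) = char_poly (A_alpha \<alpha> (generalized_corona G v H))"
    if "k \<le> graph_order G" for k
    using that
  proof (induction k)
    case 0
    have "generalized_corona G v (M 0) = generalized_corona G v H"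
      by (rule generalized_corona_cong) (simp add: M_def)
    then show ?case by simp
  next
    case (Suc k)
    interpret corona G v "M k"
      using G v H K by (intro corona.intro) (simp_all add: M_def)
    have "M (Suc k) = (M k)(Suc k := K (Suc k))"
      by (rule ext) (auto simp: M_def)
    moreover have "Suc k \<in> {1..graph_order G}" using Suc.prems by simp
    moreover have "M k (Suc k) = H (Suc k)" by (simp add: M_def)
    ultimately have "char_poly (A_alpha \<alpha> (generalized_corona G v (M (Suc k)))) = char_poly (A_alpha \<alpha> C)"
      using char_poly_corona_update[of "Suc k" "K (Suc k)" \<alpha>] K poly coronal by simp
    then show ?case using Suc by simp
  qed
  moreover have "generalized_corona G v (M (graph_order G)) = generalized_corona G v K"
    by (rule generalized_corona_cong) (simp add: M_def)
  ultimately show ?thesis by (metis order_refl)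
qed

section \<open>Isomorphisms of coronas\<close>

text \<open>
  An isomorphism of digraphs carries a separate map on arcs. Here arcs are pairs of their end
  points, so the vertex map determines it.
\<close>

lemma digraph_iso_with_proj_iff:
  assumes X: "pair_graph X" and Y: "pair_graph Y"
  shows "digraph_iso (with_proj X) (with_proj Y) \<longleftrightarrow>
    (\<exists>f. bij_betw f (pverts X) (pverts Y) \<and>
      (\<forall>x \<in> pverts X. \<forall>y \<in> pverts X. (x, y) \<in> parcs X \<longleftrightarrow> (f x, f y) \<in> parcs Y))"
    (is "?L \<longleftrightarrow> ?R")
proof
  interpret X: pair_graph X by (rule X)
  assume ?L
  then obtain h where h: "X.digraph_isomorphism h" and Yh: "with_proj Y = app_iso h (with_proj X)"
    unfolding digraph_iso_def by blast
  let ?f = "iso_verts h"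
  have inj: "inj_on ?f (pverts X)"
    using h by (simp add: X.digraph_isomorphism_def)
  have arc: "iso_arcs h (x, y) = (?f x, ?f y)" if "(x, y) \<in> parcs X" for x y
  proof -
    have "iso_tail h = fst" "iso_head h = snd"
      using arg_cong[OF Yh, of tail] arg_cong[OF Yh, of head] by simp_all
    then show ?thesis
      using h that unfolding X.digraph_isomorphism_def by (metis fst_conv snd_conv prod.collapse)
  qed
  have arcs: "parcs Y = iso_arcs h ` parcs X"
    using arg_cong[OF Yh, of arcs] by simp
  have "(x, y) \<in> parcs X \<longleftrightarrow> (?f x, ?f y) \<in> parcs Y" if "x \<in> pverts X" "y \<in> pverts X" for x y
  proof
    show "(?f x, ?f y) \<in> parcs Y" if "(x, y) \<in> parcs X"
      using that arc unfolding arcs by force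
    assume "(?f x, ?f y) \<in> parcs Y"
    then obtain x' y' where a: "(x', y') \<in> parcs X" "(?f x, ?f y) = iso_arcs h (x', y')"
      unfolding arcs by auto
    then have "?f x = ?f x'" "?f y = ?f y'" "x' \<in> pverts X" "y' \<in> pverts X"
      using arc pair_graphD(2)[OF X a(1)] by auto
    with that have "x = x'" "y = y'" using inj by (blast dest: inj_onD)+
    with a(1) show "(x, y) \<in> parcs X" by simp
  qed
  moreover have "bij_betw ?f (pverts X) (pverts Y)"
    using inj arg_cong[OF Yh, of verts] by (simp add: bij_betw_def)
  ultimately show ?R by blast
next
  interpret X: pair_graph X by (rule X)
  assume ?R
  then obtain f where f: "bij_betw f (pverts X) (pverts Y)"
    and adj: "\<And>x y. x \<in> pverts X \<Longrightarrow> y \<in> pverts X \<Longrightarrow> (x, y) \<in> parcs X \<longleftrightarrow> (f x, f y) \<in> parcs Y"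
    by blast
  let ?h = "\<lparr>iso_verts = f, iso_arcs = map_prod f f, iso_head = snd, iso_tail = fst\<rparr>"
  have inj: "inj_on f (pverts X)" using f by (rule bij_betw_imp_inj_on)
  have sub: "parcs X \<subseteq> pverts X \<times> pverts X"
    using pair_graphD(2)[OF X] by auto
  have "inj_on (map_prod f f) (parcs X)"
    using map_prod_inj_on[OF inj inj] sub by (rule inj_on_subset)
  then have iso: "X.digraph_isomorphism ?h"
    using inj X.wf_digraph_axioms by (simp add: X.digraph_isomorphism_def)
  have "map_prod f f ` parcs X = parcs Y"
  proof
    show "map_prod f f ` parcs X \<subseteq> parcs Y"
      using adj sub by auto
    show "parcs Y \<subseteq> map_prod f f ` parcs X"
    proof (rule subrelI)
      fix a b assume ab: "(a, b) \<in> parcs Y"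
      then obtain x y where "x \<in> pverts X" "y \<in> pverts X" "a = f x" "b = f y"
        using pair_graphD(2)[OF Y ab] bij_betw_imp_surj_on[OF f] by blast
      then show "(a, b) \<in> map_prod f f ` parcs X"
        using adj ab by force
    qed
  qed
  then have "with_proj Y = app_iso ?h (with_proj X)"
    using bij_betw_imp_surj_on[OF f] by (simp add: app_iso_def with_proj_def)
  with iso show ?L unfolding digraph_iso_def by blast
qed

lemma degree_iso:
  assumes X: "pair_graph X" and Y: "pair_graph Y" and f: "bij_betw f (pverts X) (pverts Y)"
    and adj: "\<And>x y. x \<in> pverts X \<Longrightarrow> y \<in> pverts X \<Longrightarrow> (x, y) \<in> parcs X \<longleftrightarrow> (f x, f y) \<in> parcs Y"
    and x: "x \<in> pverts X"
  shows "card (parcs Y `` {f x}) = card (parcs X `` {x})"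
proof -
  have "f ` (parcs X `` {x}) = parcs Y `` {f x}"
  proof
    show "f ` (parcs X `` {x}) \<subseteq> parcs Y `` {f x}"
    proof
      fix b assume "b \<in> f ` (parcs X `` {x})"
      then obtain y where y: "(x, y) \<in> parcs X" "b = f y" by auto
      then have "y \<in> pverts X" using pair_graphD(2)[OF X y(1)] by simp
      then show "b \<in> parcs Y `` {f x}" using adj[OF x] y by simp
    qed
    show "parcs Y `` {f x} \<subseteq> f ` (parcs X `` {x})"
    proof
      fix b assume b: "b \<in> parcs Y `` {f x}"
      then have "b \<in> pverts Y" using pair_graphD(2)[OF Y, of "f x" b] by simp
      then obtain y where "y \<in> pverts X" "b = f y"
        using bij_betw_imp_surj_on[OF f] by blast
      then show "b \<in> f ` (parcs X `` {x})"
        using adj[OF x] b by auto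
    qed
  qed
  moreover have "inj_on f (parcs X `` {x})"
    using bij_betw_imp_inj_on[OF f] by (rule inj_on_subset) (use pair_graphD(2)[OF X, of x] in blast)
  ultimately show ?thesis
    by (metis card_image)
qed

text \<open>
  The image of the hub \<open>v i\<close> decides which graph \<open>K j\<close> corresponds to \<open>H i\<close>. If it is a hub \<open>v j\<close>, then
  the leaves at \<open>v i\<close> go to neighbours of \<open>v j\<close>. No such leaf can go to a hub \<open>u\<close>: this \<open>u\<close> would be
  adjacent to \<open>v j\<close> in \<open>G\<close> and so have degree more than \<open>t\<close>, while a leaf has degree at most \<open>t\<close>. So
  \<open>H i\<close> is mapped into \<open>K j\<close>, and onto it for reasons of cardinality.

  If the image is a leaf \<open>x\<close> of \<open>K j\<close>, then the \<open>t\<close> leaves at \<open>v i\<close> go to neighbours of \<open>x\<close>, which lie among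
  \<open>v j\<close> and the \<open>t - 1\<close> other vertices of \<open>K j\<close>. So they fill this set, and \<open>x\<close> is adjacent to all of it.
  Since \<open>v j\<close> is adjacent to all vertices of \<open>K j\<close> too, it can take the place of \<open>x\<close>, and the set induces a
  copy of \<open>K j\<close>.
\<close>

lemma corona_iso_imp_block_iso:
  fixes H K :: "nat \<Rightarrow> 'b pair_pre_digraph"
  assumes G: "pair_graph G" and v: "bij_betw v {1..graph_order G} (pverts G)"
    and H: "\<And>i. i \<in> {1..graph_order G} \<Longrightarrow> pair_graph (H i)"
    and K: "\<And>i. i \<in> {1..graph_order G} \<Longrightarrow> pair_graph (K i)"
    and tH: "\<And>i. i \<in> {1..graph_order G} \<Longrightarrow> graph_order (H i) = t"
    and tK: "\<And>i. i \<in> {1..graph_order G} \<Longrightarrow> graph_order (K i) = t"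
    and iso: "digraph_iso (with_proj (generalized_corona G v H)) (with_proj (generalized_corona G v K))"
    and i: "i \<in> {1..graph_order G}"
  shows "\<exists>j \<in> {1..graph_order G}. digraph_iso (with_proj (H i)) (with_proj (K j))"
proof -
  interpret H: corona G v H using G v H by (rule corona.intro)
  interpret K: corona G v K using G v K by (rule corona.intro)
  obtain f where f: "bij_betw f (pverts H.C) (pverts K.C)"
    and adj: "\<And>x y. x \<in> pverts H.C \<Longrightarrow> y \<in> pverts H.C \<Longrightarrow> (x, y) \<in> parcs H.C \<longleftrightarrow> (f x, f y) \<in> parcs K.C"
    using iso unfolding digraph_iso_with_proj_iff[OF H.C K.C] by blast
  let ?B = "Inr ` Pair i ` pverts (H i)"
  let ?c = "Inl (v i)"
  have c: "?c \<in> pverts H.C" using i by simp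
  have B: "?B \<subseteq> pverts H.C" using i by auto
  have cB: "(?c, b) \<in> parcs H.C" if "b \<in> ?B" for b using that i by auto
  have injB: "inj_on f ?B" using bij_betw_imp_inj_on[OF f] B by (rule inj_on_subset)
  have cardB: "card (f ` ?B) = t"
    using injB tH[OF i] by (simp add: card_image inj_on_def)
  have fB_eqI: "f ` ?B = T" if "finite T" "f ` ?B \<subseteq> T" "card T = t" for T
    using card_subset_eq[OF that(1,2)] that(3) cardB by argo
  have fcB: "(f ?c, f b) \<in> parcs K.C" if "b \<in> ?B" for b
    using adj[OF c, of b] cB[OF that] B that by blast
  (* T is the image of the block, and h identifies it with some K j; the two cases below differ only
     in T and h. *)
  have block_iso: ?thesis
    if j: "j \<in> {1..graph_order G}" and fB: "f ` ?B = T" and h: "bij_betw h T (pverts (K j))"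
      and hadj: "\<And>a b. a \<in> T \<Longrightarrow> b \<in> T \<Longrightarrow> (a, b) \<in> parcs K.C \<longleftrightarrow> (h a, h b) \<in> parcs (K j)"
    for j T h
  proof -
    let ?e = "Inr \<circ> Pair i :: 'b \<Rightarrow> 'a + nat \<times> 'b"
    have "bij_betw ?e (pverts (H i)) ?B"
      by (auto simp: bij_betw_def inj_on_def)
    moreover have "bij_betw f ?B T"
      using injB fB by (simp add: bij_betw_def)
    ultimately have g: "bij_betw (h \<circ> (f \<circ> ?e)) (pverts (H i)) (pverts (K j))"
      using h by (blast intro: bij_betw_trans)
    have "(x, y) \<in> parcs (H i) \<longleftrightarrow> ((h \<circ> (f \<circ> ?e)) x, (h \<circ> (f \<circ> ?e)) y) \<in> parcs (K j)"
      if "x \<in> pverts (H i)" "y \<in> pverts (H i)" for x y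
    proof -
      have xy: "?e x \<in> ?B" "?e y \<in> ?B" using that by auto
      have "(x, y) \<in> parcs (H i) \<longleftrightarrow> (?e x, ?e y) \<in> parcs H.C" using i by simp
      also have "\<dots> \<longleftrightarrow> (f (?e x), f (?e y)) \<in> parcs K.C"
        using adj xy B by blast
      also have "\<dots> \<longleftrightarrow> (h (f (?e x)), h (f (?e y))) \<in> parcs (K j)"
        using hadj xy fB by blast
      finally show ?thesis by simp
    qed
    with g have "digraph_iso (with_proj (H i)) (with_proj (K j))"
      unfolding digraph_iso_with_proj_iff[OF H[OF i] K[OF j]] by blast
    with j show ?thesis by blast
  qed
  have fc: "f ?c \<in> pverts K.C" using bij_betwE[OF f] c by blast
  show ?thesis
  proof (cases "f ?c")
    case (Inl w)
    then obtain j where j: "j \<in> {1..graph_order G}" and w: "w = v j"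
      using fc K.v_cases[of w] by auto
    let ?T = "Inr ` Pair j ` pverts (K j)"
    have "f ` ?B \<subseteq> ?T"
    proof
      fix b assume "b \<in> f ` ?B"
      then obtain y where y: "y \<in> pverts (H i)" and b: "b = f (Inr (i, y))" by auto
      have arc: "(Inl (v j), b) \<in> parcs K.C"
        using fcB[of "Inr (i, y)"] y by (simp add: Inl w b)
      show "b \<in> ?T"
      proof (cases b)
        case (Inr p)
        then show ?thesis using arc j K.v_eq_iff[OF j] by (cases p) auto
      next
        case b': (Inl u)
        with arc have u: "(v j, u) \<in> parcs G" by simp
        note u' = pair_graphD(2)[OF G u]
        obtain l where l: "l \<in> {1..graph_order G}" "u = v l"
          using K.v_cases[of u] u' by blast
        have "parcs G `` {u} \<noteq> {}" using u' by blast
        then have "0 < card (parcs G `` {u})"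
          using neighbours_finite[OF G] by (simp add: card_gt_0_iff)
        then have "t < card (parcs K.C `` {b})"
          using K.degree_hub[OF l(1)] tK[OF l(1)] by (simp add: b' l(2))
        also have "card (parcs K.C `` {b}) = card (parcs H.C `` {Inr (i, y)})"
          unfolding b using i y by (intro degree_iso[OF H.C K.C f adj]) simp_all
        also have "\<dots> = card (parcs (H i) `` {y}) + 1"
          using H.degree_leaf[OF i y] .
        also have "\<dots> \<le> t"
        proof -
          have "parcs (H i) `` {y} \<subset> pverts (H i)"
            using pair_graphD(2)[OF H[OF i]] y by blast
          then have "card (parcs (H i) `` {y}) < graph_order (H i)"
            by (rule psubset_card_mono[OF pair_graphD(1)[OF H[OF i]]])
          then show ?thesis using tH[OF i] by simp
        qed
        finally show ?thesis by simp
      qed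
    qed
    moreover have "card ?T = t"
      using tK[OF j] by (simp add: card_image inj_on_def)
    ultimately have fB: "f ` ?B = ?T"
      using pair_graphD(1)[OF K[OF j]] by (intro fB_eqI) simp_all
    show ?thesis
    proof (rule block_iso[OF j fB])
      show "bij_betw (snd \<circ> projr) ?T (pverts (K j))"
        by (rule bij_betw_byWitness[where f' = "Inr \<circ> Pair j"]) auto
    qed (use j in auto)
  next
    case (Inr p)
    obtain j x where p: "p = (j, x)" by (cases p)
    with Inr fc have j: "j \<in> {1..graph_order G}" and x: "x \<in> pverts (K j)" by auto
    let ?T = "insert (Inl (v j)) (Inr ` Pair j ` (pverts (K j) - {x}))"
    have sub: "f ` ?B \<subseteq> parcs K.C `` {Inr (j, x)}"
      using fcB by (auto simp: Inr p)
    also have "\<dots> \<subseteq> ?T"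
      unfolding K.neighbours_leaf[OF j x] using pair_graphD(2)[OF K[OF j]] by blast
    finally have "f ` ?B \<subseteq> ?T" .
    moreover have "card ?T = t"
    proof -
      have "card ?T = Suc (card (pverts (K j) - {x}))"
        using pair_graphD(1)[OF K[OF j]]
        by (subst card_insert_disjoint) (auto simp: card_image inj_on_def)
      also have "\<dots> = t"
        using card_Suc_Diff1[OF pair_graphD(1)[OF K[OF j]] x] tK[OF j] by simp
      finally show ?thesis .
    qed
    ultimately have fB: "f ` ?B = ?T"
      using pair_graphD(1)[OF K[OF j]] by (intro fB_eqI) simp_all
    have univ: "(x, z) \<in> parcs (K j)" if "z \<in> pverts (K j)" "z \<noteq> x" for z
    proof -
      have "Inr (j, z) \<in> ?T" using that by auto
      with fB sub have "Inr (j, z) \<in> parcs K.C `` {Inr (j, x)}" by blast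
      then show ?thesis by simp
    qed
    have univ': "(z, x) \<in> parcs (K j)" if "z \<in> pverts (K j)" "z \<noteq> x" for z
      using pair_graphD(2)[OF K[OF j] univ[OF that]] by blast
    have loop: "(x, x) \<notin> parcs (K j)" "(v j, v j) \<notin> parcs G"
      using pair_graphD(2)[OF K[OF j]] pair_graphD(2)[OF G] by blast+
    (* The hub v j plays the part of the missing vertex x. *)
    let ?h = "\<lambda>a. case a of Inl _ \<Rightarrow> x | Inr (_, z) \<Rightarrow> z"
    show ?thesis
    proof (rule block_iso[OF j fB])
      show "bij_betw ?h ?T (pverts (K j))"
        by (rule bij_betw_byWitness[where f' = "\<lambda>z. if z = x then Inl (v j) else Inr (j, z)"])
          (use x in auto)
      show "(a, b) \<in> parcs K.C \<longleftrightarrow> (?h a, ?h b) \<in> parcs (K j)" if "a \<in> ?T" "b \<in> ?T" for a b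
      proof -
        have "a = Inl (v j) \<or> (\<exists>y \<in> pverts (K j). y \<noteq> x \<and> a = Inr (j, y))"
          "b = Inl (v j) \<or> (\<exists>y \<in> pverts (K j). y \<noteq> x \<and> b = Inr (j, y))"
          using that by blast+
        then show ?thesis
          by (elim disjE bexE conjE) (use j in \<open>simp_all add: loop univ univ'\<close>)
      qed
    qed
  qed
qed

section \<open>Cospectral coronas\<close>

theorem corollary3p4:
  fixes \<alpha> :: real and n :: nat
    and G :: "'a pair_pre_digraph" and v :: "nat \<Rightarrow> 'a"
    and H :: "nat \<Rightarrow> 'b pair_pre_digraph"
    and \<chi> :: "real poly fract"
  assumes "0 \<le> \<alpha>" and "\<alpha> \<le> 1"
    and "pair_graph G" and "graph_order G = n" and "1 \<le> n"
    and "bij_betw v {1..n} (pverts G)"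
    and "\<And>i. i \<in> {1..2 * n} \<Longrightarrow> pair_graph (H i)"
    and "\<And>i j. i \<in> {1..2 * n} \<Longrightarrow> j \<in> {1..2 * n} \<Longrightarrow> i \<noteq> j \<Longrightarrow> A_alpha_cospectral \<alpha> (H i) (H j)"
    and "\<And>i. i \<in> {1..2 * n} \<Longrightarrow> A_alpha_coronal \<alpha> (H i) = \<chi>"
  shows "A_alpha_cospectral \<alpha> (generalized_corona G v H) (generalized_corona G v (\<lambda>i. H (n + i)))"
proof -
  note G = assms(3) and n = assms(4,5) and H = assms(7) and cospectral = assms(8) and coronal = assms(9)
  have v: "bij_betw v {1..graph_order G} (pverts G)" using assms(6) n by simp
  have poly: "char_poly (A_alpha \<alpha> (H i)) = char_poly (A_alpha \<alpha> (H j))"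
    if "i \<in> {1..2 * n}" "j \<in> {1..2 * n}" for i j
    using cospectral[OF that] by (cases "i = j") (auto simp: A_alpha_cospectral_def A_alpha_spectrum_eq_iff)
  have order: "graph_order (H i) = graph_order (H 1)" if "i \<in> {1..2 * n}" for i
    using poly[OF that, of 1] n by (intro graph_order_eq_if_char_poly_eq) simp
  have range: "i \<in> {1..2 * n}" "n + i \<in> {1..2 * n}" if "i \<in> {1..graph_order G}" for i
    using that n by auto
  have "char_poly (A_alpha \<alpha> (generalized_corona G v H)) =
      char_poly (A_alpha \<alpha> (generalized_corona G v (\<lambda>i. H (n + i))))"
    using G v range H poly coronal by (intro char_poly_corona_cong) simp_all
  moreover have "\<not> digraph_iso (with_proj (generalized_corona G v H))
      (with_proj (generalized_corona G v (\<lambda>i. H (n + i))))"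
  proof
    assume iso: "digraph_iso (with_proj (generalized_corona G v H))
      (with_proj (generalized_corona G v (\<lambda>i. H (n + i))))"
    have 1: "1 \<in> {1..graph_order G}" using n by simp
    obtain j where j: "j \<in> {1..graph_order G}" and j_iso: "digraph_iso (with_proj (H 1)) (with_proj (H (n + j)))"
      using corona_iso_imp_block_iso[OF G v H[OF range(1)] H[OF range(2)]
          order[OF range(1)] order[OF range(2)] iso 1] by blast
    have "1 \<noteq> n + j" using j n by simp
    then show False
      using cospectral[OF range(1)[OF 1] range(2)[OF j]] j_iso by (simp add: A_alpha_cospectral_def)
  qed
  ultimately show ?thesis
    by (simp add: A_alpha_cospectral_def A_alpha_spectrum_eq_iff)
qed

end
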